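(* Let $W=W_{Z|X,Y}$ be a two-user discrete memoryless multiple access channel with finite input alphabets $\mathcal{X},\mathcal{Y}$ and finite output alphabet $\mathcal{Z}$, let $\mathcal{C}$ be its capacity region of communication with adversary identification, and let $\tilde{\mathcal{W}}_W$ be the AV-MAC associated with $W$ (defined in the context). Then $$\mathcal{C}\subseteq\mathcal{C}_{\mathrm{AV\text{-}MAC}}(\tilde{\mathcal{W}}_W).$$ Moreover, there exists an AV-MAC $\mathcal{W}_W$ such that $\mathcal{C}_{\mathrm{AV\text{-}MAC}}(\mathcal{W}_W)=\mathcal{C}_{\mathrm{AV\text{-}MAC}}(\tilde{\mathcal{W}}_W)$ and $|\mathcal{W}_W|\le 2^{|\mathcal{X}|^2+|\mathcal{Y}|^2}$.
   Context: **Codes.** An $(N_{\mathsf{A}},N_{\mathsf{B}},n)$ deterministic adversary identifying code consists of message sets $\mathcal{M}_i=\{1,\dots,N_i\}$, $i\in\{\mathsf{A},\mathsf{B}\}$, deterministic encoders $f_{\mathsf{A}}:\mathcal{M}_{\mathsf{A}}\to\mathcal{X}^n$, $f_{\mathsf{B}}:\mathcal{M}_{\mathsf{B}}\to\mathcal{Y}^n$, and a deterministic decoder $\phi:\mathcal{Z}^n\to(\mathcal{M}_{\mathsf{A}}\times\mathcal{M}_{\mathsf{B}})\cup\{\mathbf{a},\mathbf{b}\}$, where the output symbol $\mathbf{a}$ (resp. $\mathbf{b}$) declares user $\mathsf{A}$ (resp. $\mathsf{B}$) to be adversarial. $W^n$ is the $n$-fold product channel. **Error probability.** $P_{e,\mathrm{hon}}=\frac{1}{N_{\mathsf{A}}N_{\mathsf{B}}}\sum_{m_{\mathsf{A}},m_{\mathsf{B}}}W^n(\{z:\phi(z)\ne(m_{\mathsf{A}},m_{\mathsf{B}})\}\mid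 f_{\mathsf{A}}(m_{\mathsf{A}}),f_{\mathsf{B}}(m_{\mathsf{B}}))$; $P_{e,\mathrm{mal}\,\mathsf{A}}=\max_{x\in\mathcal{X}^n}\frac{1}{N_{\mathsf{B}}}\sum_{m_{\mathsf{B}}}W^n(\{z:\phi(z)\notin(\mathcal{M}_{\mathsf{A}}\times\{m_{\mathsf{B}}\})\cup\{\mathbf{a}\}\}\mid x,f_{\mathsf{B}}(m_{\mathsf{B}}))$; $P_{e,\mathrm{mal}\,\mathsf{B}}=\max_{y\in\mathcal{Y}^n}\frac{1}{N_{\mathsf{A}}}\sum_{m_{\mathsf{A}}}W^n(\{z:\phi(z)\notin(\{m_{\mathsf{A}}\}\times\mathcal{M}_{\mathsf{B}})\cup\{\mathbf{b}\}\}\mid f_{\mathsf{A}}(m_{\mathsf{A}}),y)$. The average probability of error is $P_e=\max\{P_{e,\mathrm{hon}},P_{e,\mathrm{mal}\,\mathsf{A}},P_{e,\mathrm{mal}\,\mathsf{B}}\}$. **Capacity region.** $(R_{\mathsf{A}},R_{\mathsf{B}})$ (nonnegative reals) is achievable if there is a sequence of $(\lfloor 2^{nR_{\mathsf{A}}}\rfloor,\lfloor 2^{nR_{\mathsf{B}}}\rfloor,n)$ adversary identifying codes, $n=1,2,\dots$, with $P_e\to0$. $\mathcal{C}\subseteq\mathbb{R}^2$ is the closure of the set of achievable pairs. **AV-MAC.** An arbitrarily varying multiple access channel (AV-MAC) is a family $\mathcal{W}=\{W(\cdot|\cdot,\cdot,s):s\in\mathcal{S}\}$ of MACs with input alphabets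 $\mathcal{X},\mathcal{Y}$ and output alphabet $\mathcal{Z}$, indexed by a state set $\mathcal{S}$; the state may vary arbitrarily from one channel use to the next. $\mathcal{C}_{\mathrm{AV\text{-}MAC}}(\mathcal{W})$ denotes its deterministic-code capacity region: the closure of the set of rate pairs $(R_{\mathsf{A}},R_{\mathsf{B}})$ for which there are deterministic encoders $f_{\mathsf{A}}:\{1,\dots,\lfloor 2^{nR_{\mathsf{A}}}\rfloor\}\to\mathcal{X}^n$, $f_{\mathsf{B}}:\{1,\dots,\lfloor 2^{nR_{\mathsf{B}}}\rfloor\}\to\mathcal{Y}^n$ and deterministic decoders producing message pairs such that the probability of decoding a wrong message pair, averaged over uniformly distributed message pairs and then maximized (supremum) over all state sequences $(s_1,\dots,s_n)\in\mathcal{S}^n$ (with channel law $\prod_{i=1}^nW(z_i|x_i,y_i,s_i)$), tends to $0$ as $n\to\infty$. **The AV-MAC $\tilde{\mathcal{W}}_W$.** $\tilde{\mathcal{W}}_W$ is the set of all MACs $\tilde W$ for which there exist conditional distributions $Q_{X'|X}$ (from $\mathcal{X}$ to $\mathcal{X}$) and $Q_{Y'|Y}$ (from $\mathcal{Y}$ to $\mathcal{Y}$) such that for all $(x,y,z)\in\mathcal{X}\times\mathcal{Y}\times\mathcal{Z}$, $$\tilde W(z|x,y)=\sum_{x'}Q_{X'|X}(x'|x)W(z|x',y)=\sum_{y'}Q_{Y'|Y}(y'|y)W(z|x,y').$$ It is regarded as an AV-MAC whose states are its elements. $|\mathcal{W}_W|$ denotes the number of MACs in the family $\mathcal{W}_W$.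 *)

theory Defs
  imports "HOL-Probability.Probability"
begin

type_synonym ('x, 'y, 'z) mac = "'x \<Rightarrow> 'y \<Rightarrow> 'z pmf"

text \<open>
  A word of length \<open>n\<close> over \<open>'a\<close> is an extensional function on \<open>{..<n}\<close>. The default value in
  \<open>Pi_pmf\<close> below is \<open>undefined\<close>, so that the channel output law is supported on \<open>words n\<close>.
\<close>

definition words :: "nat \<Rightarrow> (nat \<Rightarrow> 'a) set" where
  "words n = ({..<n} \<rightarrow>\<^sub>E UNIV)"

definition product_channel ::
    "('x, 'y, 'z) mac \<Rightarrow> nat \<Rightarrow> (nat \<Rightarrow> 'x) \<Rightarrow> (nat \<Rightarrow> 'y) \<Rightarrow> (nat \<Rightarrow> 'z) pmf" where
  "product_channel W n x y = Pi_pmf {..<n} undefined (\<lambda>i. W (x i) (y i))"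

definition num_messages :: "nat \<Rightarrow> real \<Rightarrow> nat" where
  "num_messages n R = nat \<lfloor>2 powr (real n * R)\<rfloor>"

datatype verdict = Decoded "nat \<times> nat" | Accuse_A | Accuse_B

definition adv_id_code ::
    "nat \<Rightarrow> nat \<Rightarrow> nat \<Rightarrow> (nat \<Rightarrow> nat \<Rightarrow> 'x) \<Rightarrow> (nat \<Rightarrow> nat \<Rightarrow> 'y) \<Rightarrow> ((nat \<Rightarrow> 'z) \<Rightarrow> verdict) \<Rightarrow> bool" where
  "adv_id_code NA NB n fA fB \<phi> \<longleftrightarrow>
     fA \<in> {1..NA} \<rightarrow> words n \<and>
     fB \<in> {1..NB} \<rightarrow> words n \<and>
     \<phi> \<in> words n \<rightarrow> Decoded ` ({1..NA} \<times> {1..NB}) \<union> {Accuse_A, Accuse_B}"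

definition err_hon ::
    "('x, 'y, 'z) mac \<Rightarrow> nat \<Rightarrow> nat \<Rightarrow> nat \<Rightarrow> (nat \<Rightarrow> nat \<Rightarrow> 'x) \<Rightarrow> (nat \<Rightarrow> nat \<Rightarrow> 'y) \<Rightarrow>
      ((nat \<Rightarrow> 'z) \<Rightarrow> verdict) \<Rightarrow> real" where
  "err_hon W NA NB n fA fB \<phi> =
     1 / (real NA * real NB) * (\<Sum>mA\<in>{1..NA}. \<Sum>mB\<in>{1..NB}.
       measure_pmf.prob (product_channel W n (fA mA) (fB mB)) {z. \<phi> z \<noteq> Decoded (mA, mB)})"

definition err_mal_A ::
    "('x::finite, 'y::finite, 'z) mac \<Rightarrow> nat \<Rightarrow> nat \<Rightarrow> nat \<Rightarrow> (nat \<Rightarrow> nat \<Rightarrow> 'y) \<Rightarrow>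
      ((nat \<Rightarrow> 'z) \<Rightarrow> verdict) \<Rightarrow> real" where
  "err_mal_A W NA NB n fB \<phi> =
     (MAX x\<in>words n. 1 / real NB * (\<Sum>mB\<in>{1..NB}.
       measure_pmf.prob (product_channel W n x (fB mB))
         {z. \<phi> z \<notin> Decoded ` ({1..NA} \<times> {mB}) \<union> {Accuse_A}}))"

definition err_mal_B ::
    "('x::finite, 'y::finite, 'z) mac \<Rightarrow> nat \<Rightarrow> nat \<Rightarrow> nat \<Rightarrow> (nat \<Rightarrow> nat \<Rightarrow> 'x) \<Rightarrow>
      ((nat \<Rightarrow> 'z) \<Rightarrow> verdict) \<Rightarrow> real" where
  "err_mal_B W NA NB n fA \<phi> =
     (MAX y\<in>words n. 1 / real NA * (\<Sum>mA\<in>{1..NA}.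
       measure_pmf.prob (product_channel W n (fA mA) y)
         {z. \<phi> z \<notin> Decoded ` ({mA} \<times> {1..NB}) \<union> {Accuse_B}}))"

definition err_adv_id ::
    "('x::finite, 'y::finite, 'z) mac \<Rightarrow> nat \<Rightarrow> nat \<Rightarrow> nat \<Rightarrow> (nat \<Rightarrow> nat \<Rightarrow> 'x) \<Rightarrow> (nat \<Rightarrow> nat \<Rightarrow> 'y) \<Rightarrow>
      ((nat \<Rightarrow> 'z) \<Rightarrow> verdict) \<Rightarrow> real" where
  "err_adv_id W NA NB n fA fB \<phi> =
     Max {err_hon W NA NB n fA fB \<phi>, err_mal_A W NA NB n fB \<phi>, err_mal_B W NA NB n fA \<phi>}"

definition adv_id_achievable :: "('x::finite, 'y::finite, 'z) mac \<Rightarrow> real \<times> real \<Rightarrow> bool" where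
  "adv_id_achievable W = (\<lambda>(RA, RB). 0 \<le> RA \<and> 0 \<le> RB \<and>
     (\<exists>fA fB \<phi>.
        (\<forall>n\<ge>1. adv_id_code (num_messages n RA) (num_messages n RB) n (fA n) (fB n) (\<phi> n)) \<and>
        (\<lambda>n. err_adv_id W (num_messages n RA) (num_messages n RB) n (fA n) (fB n) (\<phi> n))
          \<longlonglongrightarrow> 0))"

definition adv_id_capacity :: "('x::finite, 'y::finite, 'z) mac \<Rightarrow> (real \<times> real) set" where
  "adv_id_capacity W = closure {R. adv_id_achievable W R}"

text \<open>
  An AV-MAC is given by a nonempty state set \<open>S\<close> and a family \<open>V\<close> of channels, of which only the
  members \<open>V s\<close> with \<open>s \<in> S\<close> matter. The supremum in \<open>err_av\<close> is only meaningful for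
  \<open>S \<noteq> {}\<close>.
\<close>

definition av_product_channel ::
    "('s \<Rightarrow> ('x, 'y, 'z) mac) \<Rightarrow> nat \<Rightarrow> (nat \<Rightarrow> 's) \<Rightarrow> (nat \<Rightarrow> 'x) \<Rightarrow> (nat \<Rightarrow> 'y) \<Rightarrow>
      (nat \<Rightarrow> 'z) pmf" where
  "av_product_channel V n s x y = Pi_pmf {..<n} undefined (\<lambda>i. V (s i) (x i) (y i))"

definition av_code ::
    "nat \<Rightarrow> nat \<Rightarrow> nat \<Rightarrow> (nat \<Rightarrow> nat \<Rightarrow> 'x) \<Rightarrow> (nat \<Rightarrow> nat \<Rightarrow> 'y) \<Rightarrow>
      ((nat \<Rightarrow> 'z) \<Rightarrow> nat \<times> nat) \<Rightarrow> bool" where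
  "av_code NA NB n fA fB \<phi> \<longleftrightarrow>
     fA \<in> {1..NA} \<rightarrow> words n \<and>
     fB \<in> {1..NB} \<rightarrow> words n \<and>
     \<phi> \<in> words n \<rightarrow> {1..NA} \<times> {1..NB}"

definition err_av ::
    "'s set \<Rightarrow> ('s \<Rightarrow> ('x, 'y, 'z) mac) \<Rightarrow> nat \<Rightarrow> nat \<Rightarrow> nat \<Rightarrow> (nat \<Rightarrow> nat \<Rightarrow> 'x) \<Rightarrow>
      (nat \<Rightarrow> nat \<Rightarrow> 'y) \<Rightarrow> ((nat \<Rightarrow> 'z) \<Rightarrow> nat \<times> nat) \<Rightarrow> real" where
  "err_av S V NA NB n fA fB \<phi> =
     (SUP s\<in>{..<n} \<rightarrow>\<^sub>E S. 1 / (real NA * real NB) * (\<Sum>mA\<in>{1..NA}. \<Sum>mB\<in>{1..NB}.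
       measure_pmf.prob (av_product_channel V n s (fA mA) (fB mB)) {z. \<phi> z \<noteq> (mA, mB)}))"

definition av_achievable ::
    "'s set \<Rightarrow> ('s \<Rightarrow> ('x, 'y, 'z) mac) \<Rightarrow> real \<times> real \<Rightarrow> bool" where
  "av_achievable S V = (\<lambda>(RA, RB). 0 \<le> RA \<and> 0 \<le> RB \<and>
     (\<exists>fA fB \<phi>.
        (\<forall>n\<ge>1. av_code (num_messages n RA) (num_messages n RB) n (fA n) (fB n) (\<phi> n)) \<and>
        (\<lambda>n. err_av S V (num_messages n RA) (num_messages n RB) n (fA n) (fB n) (\<phi> n))
          \<longlonglongrightarrow> 0))"

definition av_capacity :: "'s set \<Rightarrow> ('s \<Rightarrow> ('x, 'y, 'z) mac) \<Rightarrow> (real \<times> real) set" where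
  "av_capacity S V = closure {R. av_achievable S V R}"

definition C_AV_MAC :: "('x, 'y, 'z) mac set \<Rightarrow> (real \<times> real) set" where
  "C_AV_MAC \<W> = av_capacity \<W> (\<lambda>V. V)"

definition W_tilde :: "('x::finite, 'y::finite, 'z) mac \<Rightarrow> ('x, 'y, 'z) mac set" where
  "W_tilde W = {V. \<exists>(QX :: 'x \<Rightarrow> 'x pmf) (QY :: 'y \<Rightarrow> 'y pmf). \<forall>x y z.
     pmf (V x y) z = (\<Sum>x'\<in>UNIV. pmf (QX x) x' * pmf (W x' y) z) \<and>
     pmf (V x y) z = (\<Sum>y'\<in>UNIV. pmf (QY y) y' * pmf (W x y') z)}"

end

theory Submission imports Defs begin

text \<open>
  An error event of the decoder obtained from an adversary identifying decoder is an error event for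
  an honest user A facing an adversarial B, or the other way round; under a channel of
  \<open>W_tilde W\<close>, which is \<open>W\<close> with either input randomly replaced, both are
  controlled by the adversarial error probabilities. For the second part, the pairs of kernels
  defining \<open>W_tilde W\<close> form a compact polytope given by affine equations and
  nonnegativity, so an extreme point is determined by its support and there are at most
  \<open>2 ^ (CARD('x)\<^sup>2 + CARD('y)\<^sup>2)\<close> of them. A state sequence of mixtures is a mixture of
  state sequences, so passing to the extreme points does not change the error of any code.
\<close>

section \<open>Mixtures of distributions and finite words\<close>

lemma prob_bind_pmf:
  "measure_pmf.prob (bind_pmf p f) A = measure_pmf.expectation p (\<lambda>x. measure_pmf.prob (f x) A)"
proof -
  have "ennreal (measure_pmf.prob (bind_pmf p f) A)
      = (\<integral>\<^sup>+x. ennreal (measure_pmf.prob (f x) A) \<partial>measure_pmf p)"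
    by (simp add: measure_pmf.emeasure_eq_measure[symmetric])
  also have "\<dots> = ennreal (measure_pmf.expectation p (\<lambda>x. measure_pmf.prob (f x) A))"
    by (intro nn_integral_eq_integral measure_pmf.integrable_const_bound[where B = 1]) auto
  finally show ?thesis
    by (simp add: integral_nonneg_AE)
qed

text \<open>The left side is the expectation under \<open>p\<close> of the sums bounded in the
  assumption. Because one law \<open>p\<close> serves all \<open>m\<close>, a bound that holds only
  on average over messages survives mixing.\<close>

lemma sum_prob_bind_le:
  assumes "\<And>s. s \<in> set_pmf p \<Longrightarrow> (\<Sum>m\<in>M. measure_pmf.prob (K m s) (A m)) \<le> B"
  shows "(\<Sum>m\<in>M. measure_pmf.prob (bind_pmf p (K m)) (A m)) \<le> B"
proof -
  have int: "integrable p (\<lambda>s. measure_pmf.prob (K m s) (A m))" for m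
    by (intro measure_pmf.integrable_const_bound[where B = 1]) auto
  have "(\<Sum>m\<in>M. measure_pmf.prob (bind_pmf p (K m)) (A m))
      = measure_pmf.expectation p (\<lambda>s. \<Sum>m\<in>M. measure_pmf.prob (K m s) (A m))"
    using int by (simp add: prob_bind_pmf Bochner_Integration.integral_sum)
  also have "\<dots> \<le> measure_pmf.expectation p (\<lambda>s. B)"
    using assms int
    by (intro integral_mono_AE Bochner_Integration.integrable_sum) (auto simp: AE_measure_pmf_iff)
  finally show ?thesis by simp
qed

lemma pmf_bind_finite:
  assumes "finite A" "set_pmf p \<subseteq> A"
  shows "pmf (bind_pmf p f) z = (\<Sum>a\<in>A. pmf p a * pmf (f a) z)"
  unfolding pmf_bind using assms by (subst integral_measure_pmf[of A]) auto

lemma pmf_with_weights: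
  assumes "finite A" "\<And>a. a \<in> A \<Longrightarrow> 0 \<le> u a" "sum u A = (1::real)"
  obtains p where "set_pmf p \<subseteq> A" "\<And>a. a \<in> A \<Longrightarrow> pmf p a = u a"
proof -
  define f where "f a = (if a \<in> A then u a else 0)" for a
  have f0: "0 \<le> f a" for a using assms by (simp add: f_def)
  have "(\<integral>\<^sup>+a. ennreal (f a) \<partial>count_space UNIV) = (\<Sum>a\<in>A. ennreal (f a))"
    using assms by (intro nn_integral_count_space') (auto simp: f_def)
  also have "\<dots> = ennreal (\<Sum>a\<in>A. f a)" using f0 by (simp add: sum_ennreal)
  also have "\<dots> = 1" using assms by (simp add: f_def)
  finally have pmf: "pmf (embed_pmf f) a = f a" for a
    using f0 by (intro pmf_embed_pmf) auto
  show ?thesis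
    by (rule that[of "embed_pmf f"]) (auto simp: set_pmf_eq pmf f_def split: if_splits)
qed

text \<open>The default \<open>undefined\<close> of the product is exactly the extensionality that
  \<open>words\<close> demands outside the index range.\<close>

lemma set_Pi_pmf_words: "x \<in> set_pmf (Pi_pmf {..<n} undefined p) \<Longrightarrow> x \<in> words n"
  by (auto simp: set_Pi_pmf PiE_dflt_def words_def PiE_def extensional_def)

lemma finite_words: "finite (words n :: (nat \<Rightarrow> 'a::finite) set)"
  unfolding words_def by (intro finite_PiE) auto

section \<open>Adversarial errors under a randomly replaced input\<close>

text \<open>The two sums in the definition are the mass functions of \<open>W\<close> with one input
  resampled. In \<open>bind_pmf\<close> form, products of such channels can be expanded by
  \<open>Pi_pmf_bind\<close>.\<close>

lemma W_tilde_iff: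
  fixes W :: "('x::finite, 'y::finite, 'z) mac"
  shows "V \<in> W_tilde W \<longleftrightarrow> (\<exists>QX QY. \<forall>x y.
    V x y = bind_pmf (QX x) (\<lambda>x'. W x' y) \<and> V x y = bind_pmf (QY y) (\<lambda>y'. W x y'))"
  by (simp add: W_tilde_def pmf_eq_iff pmf_bind_finite[OF finite[of UNIV]] all_conj_distrib)

text \<open>The identity kernels are witnesses. This supplies the nonemptiness of the state set and
  of the kernel polytope.\<close>

lemma W_tilde_self: "W \<in> W_tilde W"
  unfolding W_tilde_iff by (intro exI[of _ return_pmf]) (simp add: bind_return_pmf)

lemma err_adv_id_bounds:
  shows "err_mal_A W NA NB n fB \<phi> \<le> err_adv_id W NA NB n fA fB \<phi>"
    and "err_mal_B W NA NB n fA \<phi> \<le> err_adv_id W NA NB n fA fB \<phi>"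
  by (simp_all add: err_adv_id_def)

lemma sum_prob_le_err_mal_A:
  fixes W :: "('x::finite, 'y::finite, 'z) mac"
  assumes "x \<in> words n" "0 < NB"
  shows "(\<Sum>mB\<in>{1..NB}. measure_pmf.prob (product_channel W n x (fB mB))
         {z. \<phi> z \<notin> Decoded ` ({1..NA} \<times> {mB}) \<union> {Accuse_A}})
       \<le> real NB * err_mal_A W NA NB n fB \<phi>" (is "?s x \<le> _")
proof -
  have "1 / real NB * ?s x \<le> err_mal_A W NA NB n fB \<phi>"
    unfolding err_mal_A_def using assms finite_words by (intro Max_ge) auto
  then show ?thesis using assms by (simp add: field_simps)
qed

lemma sum_prob_le_err_mal_B:
  fixes W :: "('x::finite, 'y::finite, 'z) mac"
  assumes "y \<in> words n" "0 < NA"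
  shows "(\<Sum>mA\<in>{1..NA}. measure_pmf.prob (product_channel W n (fA mA) y)
         {z. \<phi> z \<notin> Decoded ` ({mA} \<times> {1..NB}) \<union> {Accuse_B}})
       \<le> real NA * err_mal_B W NA NB n fA \<phi>" (is "?s y \<le> _")
proof -
  have "1 / real NA * ?s y \<le> err_mal_B W NA NB n fA \<phi>"
    unfolding err_mal_B_def using assms finite_words by (intro Max_ge) auto
  then show ?thesis using assms by (simp add: field_simps)
qed

text \<open>An accusation must become some message pair, and \<open>(1, 1)\<close> is legal since
  both message sets are nonempty at nonnegative rates. Whether it is the right pair does not matter:
  accusing one user is already an error under an attack by the other.\<close>

primrec decoded_pair :: "verdict \<Rightarrow> nat \<times> nat" where
  "decoded_pair (Decoded p) = p"
| "decoded_pair Accuse_A = (1, 1)"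
| "decoded_pair Accuse_B = (1, 1)"

text \<open>The state sequence can be read both as a random attack on \<open>W\<close> by user A and
  as one by user B. A decoding error is an error under one of the two attacks, whence the factor
  2.\<close>

lemma sum_prob_W_tilde_le:
  fixes W :: "('x::finite, 'y::finite, 'z) mac"
  assumes s: "\<And>i. i < n \<Longrightarrow> s i \<in> W_tilde W" and N: "0 < NA" "0 < NB"
  shows "1 / (real NA * real NB) * (\<Sum>mA\<in>{1..NA}. \<Sum>mB\<in>{1..NB}.
     measure_pmf.prob (av_product_channel (\<lambda>V. V) n s (fA mA) (fB mB))
       {z. decoded_pair (\<phi> z) \<noteq> (mA, mB)}) \<le> 2 * err_adv_id W NA NB n fA fB \<phi>"
proof -
  obtain QX QY where
    QX: "\<And>i x y. i < n \<Longrightarrow> s i x y = bind_pmf (QX i x) (\<lambda>x'. W x' y)" and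
    QY: "\<And>i x y. i < n \<Longrightarrow> s i x y = bind_pmf (QY i y) (\<lambda>y'. W x y')"
    using s unfolding W_tilde_iff by metis
  define P where "P mA mB = av_product_channel (\<lambda>V. V) n s (fA mA) (fB mB)" for mA mB
  define EA where "EA mB = {z. \<phi> z \<notin> Decoded ` ({1..NA} \<times> {mB}) \<union> {Accuse_A}}" for mB
  define EB where "EB mA = {z. \<phi> z \<notin> Decoded ` ({mA} \<times> {1..NB}) \<union> {Accuse_B}}" for mA
  define err where "err = err_adv_id W NA NB n fA fB \<phi>"
  \<comment> \<open>A product of mixtures is a mixture of products. The law of the replaced word
    depends on \<open>mA\<close> but not on \<open>mB\<close>, and the default
    \<open>undefined\<close> keeps the word in \<open>words n\<close>.\<close>
  have PX: "P mA mB = bind_pmf (Pi_pmf {..<n} undefined (\<lambda>i. QX i (fA mA i)))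
      (\<lambda>x. product_channel W n x (fB mB))" for mA mB
    unfolding P_def av_product_channel_def product_channel_def
    by (subst Pi_pmf_bind[symmetric, where d' = undefined]) (auto intro!: Pi_pmf_cong simp: QX)
  have PY: "P mA mB = bind_pmf (Pi_pmf {..<n} undefined (\<lambda>i. QY i (fB mB i)))
      (\<lambda>y. product_channel W n (fA mA) y)" for mA mB
    unfolding P_def av_product_channel_def product_channel_def
    by (subst Pi_pmf_bind[symmetric, where d' = undefined]) (auto intro!: Pi_pmf_cong simp: QY)
  \<comment> \<open>For fixed \<open>mA\<close> the random attack word is independent of
    \<open>mB\<close>, so the average over \<open>mB\<close> is at most its maximum over
    deterministic attack words.\<close>
  have A: "(\<Sum>mB\<in>{1..NB}. measure_pmf.prob (P mA mB) (EA mB)) \<le> real NB * err" for mA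
    unfolding PX EA_def err_def
    by (rule sum_prob_bind_le, rule order_trans[OF sum_prob_le_err_mal_A])
      (auto intro: set_Pi_pmf_words N mult_left_mono err_adv_id_bounds)
  have B: "(\<Sum>mA\<in>{1..NA}. measure_pmf.prob (P mA mB) (EB mA)) \<le> real NA * err" for mB
    unfolding PY EB_def err_def
    by (rule sum_prob_bind_le, rule order_trans[OF sum_prob_le_err_mal_B])
      (auto intro: set_Pi_pmf_words N mult_left_mono err_adv_id_bounds)
  have "measure_pmf.prob (P mA mB) {z. decoded_pair (\<phi> z) \<noteq> (mA, mB)}
      \<le> measure_pmf.prob (P mA mB) (EA mB) + measure_pmf.prob (P mA mB) (EB mA)" for mA mB
  proof -
    \<comment> \<open>A wrong second message lies in \<open>EA mB\<close>, a wrong first one in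
      \<open>EB mA\<close>. Accusing B is an error when A attacks, and accusing A is one when B
      attacks.\<close>
    have "{z. decoded_pair (\<phi> z) \<noteq> (mA, mB)} \<subseteq> EA mB \<union> EB mA"
      unfolding EA_def EB_def by auto
    then have "measure_pmf.prob (P mA mB) {z. decoded_pair (\<phi> z) \<noteq> (mA, mB)}
        \<le> measure_pmf.prob (P mA mB) (EA mB \<union> EB mA)"
      by (intro measure_pmf.finite_measure_mono) auto
    also have "\<dots> \<le> measure_pmf.prob (P mA mB) (EA mB) + measure_pmf.prob (P mA mB) (EB mA)"
      by (intro measure_Un_le) auto
    finally show ?thesis .
  qed
  then have "(\<Sum>mA\<in>{1..NA}. \<Sum>mB\<in>{1..NB}. measure_pmf.prob (P mA mB) {z. decoded_pair (\<phi> z) \<noteq> (mA, mB)})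
      \<le> (\<Sum>mA\<in>{1..NA}. \<Sum>mB\<in>{1..NB}.
          measure_pmf.prob (P mA mB) (EA mB) + measure_pmf.prob (P mA mB) (EB mA))"
    by (intro sum_mono)
  \<comment> \<open>The second double sum is reordered so that each inner sum runs over the messages
    of the user who is honest in that attack.\<close>
  also have "\<dots> = (\<Sum>mA\<in>{1..NA}. \<Sum>mB\<in>{1..NB}. measure_pmf.prob (P mA mB) (EA mB))
      + (\<Sum>mB\<in>{1..NB}. \<Sum>mA\<in>{1..NA}. measure_pmf.prob (P mA mB) (EB mA))"
    unfolding sum.distrib by (subst (3) sum.swap) simp
  also have "\<dots> \<le> (\<Sum>mA\<in>{1..NA}. real NB * err) + (\<Sum>mB\<in>{1..NB}. real NA * err)"
    by (intro add_mono sum_mono A B)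
  also have "\<dots> = real NA * real NB * (2 * err)" by simp
  finally show ?thesis
    using N unfolding P_def err_def by (simp add: field_simps)
qed

section \<open>Achievable rates carry over to the arbitrarily varying channel\<close>

lemma num_messages_pos: "0 \<le> R \<Longrightarrow> 0 < num_messages n R"
  unfolding num_messages_def by (simp add: ge_one_powr_ge_zero)

lemma err_av_nonneg:
  assumes "S \<noteq> {}" and "bdd_above ((\<lambda>s. 1 / (real NA * real NB) * (\<Sum>mA\<in>{1..NA}. \<Sum>mB\<in>{1..NB}.
    measure_pmf.prob (av_product_channel V n s (fA mA) (fB mB)) {z. \<phi> z \<noteq> (mA, mB)}))
      ` ({..<n} \<rightarrow>\<^sub>E S))"
  shows "0 \<le> err_av S V NA NB n fA fB \<phi>"
proof -
  obtain s where s: "s \<in> {..<n} \<rightarrow>\<^sub>E S"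
    using assms(1) by (metis PiE_eq_empty_iff all_not_in_conv)
  show ?thesis
    unfolding err_av_def
    by (rule cSUP_upper2[OF assms(2) s]) (intro mult_nonneg_nonneg sum_nonneg measure_nonneg, simp)
qed

text \<open>The encoders are kept and the decoder is followed by \<open>decoded_pair\<close>; the
  error at most doubles, so it still tends to 0.\<close>

lemma av_achievable_if_adv_id_achievable:
  assumes "adv_id_achievable W R"
  shows "av_achievable (W_tilde W) (\<lambda>V. V) R"
proof -
  obtain RA RB where R: "R = (RA, RB)" by (cases R)
  from assms obtain fA fB \<phi> where pos: "0 \<le> RA" "0 \<le> RB"
    and code: "\<And>n. n \<ge> 1 \<Longrightarrow>
      adv_id_code (num_messages n RA) (num_messages n RB) n (fA n) (fB n) (\<phi> n)"
    and lim: "(\<lambda>n. err_adv_id W (num_messages n RA) (num_messages n RB) n (fA n) (fB n) (\<phi> n))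
       \<longlonglongrightarrow> 0"
    unfolding adv_id_achievable_def R by auto
  define \<psi> where "\<psi> n z = decoded_pair (\<phi> n z)" for n z
  have N: "0 < num_messages n RA" "0 < num_messages n RB" for n
    using pos num_messages_pos by auto
  have av: "av_code (num_messages n RA) (num_messages n RB) n (fA n) (fB n) (\<psi> n)" if "n \<ge> 1" for n
  proof -
    have "\<psi> n z \<in> {1..num_messages n RA} \<times> {1..num_messages n RB}" if "z \<in> words n" for z
    proof -
      have "\<phi> n z \<in> Decoded ` ({1..num_messages n RA} \<times> {1..num_messages n RB})
          \<union> {Accuse_A, Accuse_B}"
        using code[OF \<open>n \<ge> 1\<close>] that unfolding adv_id_code_def by blast
      then show ?thesis using N[of n] by (auto simp: \<psi>_def Suc_le_eq)
    qed
    then show ?thesis using code[OF that] unfolding adv_id_code_def av_code_def by blast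
  qed
  define e where "e n = err_adv_id W (num_messages n RA) (num_messages n RB) n (fA n) (fB n) (\<phi> n)" for n
  have le: "1 / (real (num_messages n RA) * real (num_messages n RB)) *
      (\<Sum>mA\<in>{1..num_messages n RA}. \<Sum>mB\<in>{1..num_messages n RB}.
        measure_pmf.prob (av_product_channel (\<lambda>V. V) n s (fA n mA) (fB n mB))
          {z. \<psi> n z \<noteq> (mA, mB)}) \<le> 2 * e n" if "s \<in> {..<n} \<rightarrow>\<^sub>E W_tilde W" for n s
    unfolding \<psi>_def e_def using that by (intro sum_prob_W_tilde_le N) auto
  have ne: "W_tilde W \<noteq> {}" using W_tilde_self by blast
  have "(\<lambda>n. err_av (W_tilde W) (\<lambda>V. V) (num_messages n RA) (num_messages n RB) n
      (fA n) (fB n) (\<psi> n)) \<longlonglongrightarrow> 0"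
  proof (rule real_tendsto_sandwich)
    show "\<forall>\<^sub>F n in sequentially. 0 \<le> err_av (W_tilde W) (\<lambda>V. V)
        (num_messages n RA) (num_messages n RB) n (fA n) (fB n) (\<psi> n)"
      by (intro always_eventually allI err_av_nonneg[OF ne] bdd_aboveI2) (rule le)
    show "\<forall>\<^sub>F n in sequentially. err_av (W_tilde W) (\<lambda>V. V)
        (num_messages n RA) (num_messages n RB) n (fA n) (fB n) (\<psi> n) \<le> 2 * e n"
      unfolding err_av_def using ne
      by (intro always_eventually allI cSUP_least le) (auto simp: PiE_eq_empty_iff)
    show "(\<lambda>n. 2 * e n) \<longlonglongrightarrow> 0"
      using tendsto_mult_left[OF lim, of 2] by (simp add: e_def)
  qed simp
  then show ?thesis
    unfolding av_achievable_def R using pos av by blast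
qed

section \<open>Reduction to finitely many states\<close>

text \<open>Since \<open>U\<close> does not depend on the inputs, drawing a component independently
  at each letter turns a sequence of mixtures into a random sequence over \<open>T\<close>, chosen
  without regard to the messages. An average cannot exceed the maximum; the reverse inequality is
  inclusion.\<close>

lemma err_av_mixture:
  fixes S :: "('a, 'b, 'c) mac set"
  assumes T: "finite T" "T \<noteq> {}" "T \<subseteq> S"
    and mix: "\<And>V. V \<in> S \<Longrightarrow> \<exists>U. set_pmf U \<subseteq> T \<and> (\<forall>x y. V x y = bind_pmf U (\<lambda>V'. V' x y))"
  shows "err_av S (\<lambda>V. V) NA NB n fA fB \<phi> = err_av T (\<lambda>V. V) NA NB n fA fB \<phi>"
proof -
  define A where "A m = {z. \<phi> z \<noteq> m}" for m
  define P :: "nat \<times> nat \<Rightarrow> (nat \<Rightarrow> ('a, 'b, 'c) mac) \<Rightarrow> (nat \<Rightarrow> 'c) pmf"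
    where "P = (\<lambda>(mA, mB) s. av_product_channel (\<lambda>V. V) n s (fA mA) (fB mB))"
  define M where "M = {1..NA} \<times> {1..NB}"
  define g where "g s = 1 / (real NA * real NB) * (\<Sum>m\<in>M. measure_pmf.prob (P m s) (A m))" for s
  have err: "err_av S' (\<lambda>V. V) NA NB n fA fB \<phi> = (SUP s\<in>{..<n} \<rightarrow>\<^sub>E S'. g s)" for S'
    unfolding err_av_def g_def A_def P_def M_def sum.cartesian_product
    by (simp add: case_prod_unfold)
  have fin: "finite ({..<n} \<rightarrow>\<^sub>E T)" using T by (intro finite_PiE) auto
  then have bddT: "bdd_above (g ` ({..<n} \<rightarrow>\<^sub>E T))" by simp
  have le: "g s \<le> (SUP s\<in>{..<n} \<rightarrow>\<^sub>E T. g s)" if s: "s \<in> {..<n} \<rightarrow>\<^sub>E S" for s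
  proof -
    have "\<forall>i. \<exists>U. i < n \<longrightarrow> set_pmf U \<subseteq> T \<and> (\<forall>x y. s i x y = bind_pmf U (\<lambda>V'. V' x y))"
      using mix s by blast
    then obtain U where U: "\<And>i. i < n \<Longrightarrow> set_pmf (U i) \<subseteq> T"
        "\<And>i x y. i < n \<Longrightarrow> s i x y = bind_pmf (U i) (\<lambda>V'. V' x y)"
      by metis
    have P: "P m s = bind_pmf (Pi_pmf {..<n} undefined U) (P m)" for m
      unfolding P_def av_product_channel_def case_prod_unfold
      by (subst Pi_pmf_bind[symmetric, where d' = undefined]) (auto intro!: Pi_pmf_cong simp: U(2))
    have in_T: "t \<in> {..<n} \<rightarrow>\<^sub>E T" if "t \<in> set_pmf (Pi_pmf {..<n} undefined U)" for t
      using that U(1) by (fastforce simp: set_Pi_pmf PiE_dflt_def PiE_def extensional_def)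
    \<comment> \<open>If a message set is empty, \<open>M\<close> is empty and division by zero
      makes \<open>g\<close> vanish; this case is split off before the denominator is
      cleared.\<close>
    have "(\<Sum>m\<in>M. measure_pmf.prob (P m s) (A m))
        \<le> (if real NA * real NB = 0 then 0
            else real NA * real NB * (SUP s\<in>{..<n} \<rightarrow>\<^sub>E T. g s))"
      unfolding P
    proof (rule sum_prob_bind_le)
      fix t assume "t \<in> set_pmf (Pi_pmf {..<n} undefined U)"
      then have "g t \<le> (SUP s\<in>{..<n} \<rightarrow>\<^sub>E T. g s)"
        using in_T bddT by (intro cSUP_upper) auto
      then show "(\<Sum>m\<in>M. measure_pmf.prob (P m t) (A m))
        \<le> (if real NA * real NB = 0 then 0
            else real NA * real NB * (SUP s\<in>{..<n} \<rightarrow>\<^sub>E T. g s))"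
        by (auto simp: g_def M_def field_simps)
    qed
    \<comment> \<open>In the case without messages, \<open>g t = 0\<close> for a single sequence
      over \<open>T\<close> shows that the supremum is nonnegative.\<close>
    moreover obtain t where "t \<in> set_pmf (Pi_pmf {..<n} undefined U)"
      using set_pmf_not_empty[of "Pi_pmf {..<n} undefined U"] by blast
    then have "g t \<le> (SUP s\<in>{..<n} \<rightarrow>\<^sub>E T. g s)"
      using in_T bddT by (intro cSUP_upper) auto
    ultimately show ?thesis
      by (cases "real NA * real NB = 0") (auto simp: g_def field_simps)
  qed
  have neS: "{..<n} \<rightarrow>\<^sub>E S \<noteq> {}" "{..<n} \<rightarrow>\<^sub>E T \<noteq> {}" using T by (auto simp: PiE_eq_empty_iff)
  show ?thesis unfolding err
  proof (rule antisym)
    show "(SUP s\<in>{..<n} \<rightarrow>\<^sub>E S. g s) \<le> (SUP s\<in>{..<n} \<rightarrow>\<^sub>E T. g s)"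
      using neS le by (intro cSUP_least) auto
    \<comment> \<open>\<open>S\<close> may be infinite; \<open>le\<close> is what bounds the larger
      supremum.\<close>
    show "(SUP s\<in>{..<n} \<rightarrow>\<^sub>E T. g s) \<le> (SUP s\<in>{..<n} \<rightarrow>\<^sub>E S. g s)"
      using neS T by (intro cSUP_subset_mono bdd_aboveI2[OF le] PiE_mono) auto
  qed
qed

section \<open>The polytope of kernel pairs and its vertices\<close>

text \<open>The \<open>Inl\<close> coordinates are \<open>Q\<^sub>X\<close>, the \<open>Inr\<close> coordinates are
  \<open>Q\<^sub>Y\<close>, each pair listing the input first.\<close>

definition kernel_polytope ::
    "('x::finite, 'y::finite, 'z) mac \<Rightarrow> (real ^ (('x \<times> 'x) + ('y \<times> 'y))) set" where
  "kernel_polytope W = {q. (\<forall>i. 0 \<le> q $ i) \<and>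
     (\<forall>x. (\<Sum>x'\<in>UNIV. q $ Inl (x, x')) = 1) \<and> (\<forall>y. (\<Sum>y'\<in>UNIV. q $ Inr (y, y')) = 1) \<and>
     (\<forall>x y z. (\<Sum>x'\<in>UNIV. q $ Inl (x, x') * pmf (W x' y) z)
            = (\<Sum>y'\<in>UNIV. q $ Inr (y, y') * pmf (W x y') z))}"

text \<open>Apart from nonnegativity all constraints are affine equations, so \<open>u\<close> and
  \<open>v\<close> may be negative. This allows moving along a line past a given point.\<close>

lemma kernel_polytope_affine:
  assumes "q \<in> kernel_polytope W" "r \<in> kernel_polytope W" "u + v = 1"
    and "\<And>i. 0 \<le> u * q $ i + v * r $ i"
  shows "u *\<^sub>R q + v *\<^sub>R r \<in> kernel_polytope W"
  using assms unfolding kernel_polytope_def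
  by (simp add: sum.distrib algebra_simps sum_distrib_left[symmetric])

lemma convex_kernel_polytope: "convex (kernel_polytope W)"
  by (intro convexI kernel_polytope_affine) (auto simp: kernel_polytope_def)

lemma compact_kernel_polytope: "compact (kernel_polytope W)"
  unfolding compact_eq_bounded_closed
proof
  have "q $ i \<le> 1" if q: "q \<in> kernel_polytope W" for q i
  proof -
    have nn: "0 \<le> q $ i" for i using q by (simp add: kernel_polytope_def)
    show ?thesis
    proof (cases i)
      case (Inl p)
      then have "q $ i \<le> (\<Sum>x'\<in>UNIV. q $ Inl (fst p, x'))"
        using nn member_le_sum[of "snd p" UNIV "\<lambda>x'. q $ Inl (fst p, x')"] by simp
      then show ?thesis using q by (simp add: kernel_polytope_def)
    next
      case (Inr p)
      then have "q $ i \<le> (\<Sum>y'\<in>UNIV. q $ Inr (fst p, y'))"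
        using nn member_le_sum[of "snd p" UNIV "\<lambda>y'. q $ Inr (fst p, y')"] by simp
      then show ?thesis using q by (simp add: kernel_polytope_def)
    qed
  qed
  then have "kernel_polytope W \<subseteq> cbox 0 1"
    by (auto simp: mem_box_cart) (simp add: kernel_polytope_def)
  then show "bounded (kernel_polytope W)" using bounded_cbox bounded_subset by blast
  show "closed (kernel_polytope W)"
    unfolding kernel_polytope_def
    by (intro closed_Collect_conj closed_Collect_all closed_Collect_eq closed_Collect_le
        continuous_intros)
qed

text \<open>If \<open>q\<close> and \<open>r\<close> differ, a small step from \<open>q\<close> away
  from \<open>r\<close> stays in the polytope: coordinates vanishing at \<open>q\<close> vanish at
  \<open>r\<close> too, and positive ones stay positive. Then \<open>q\<close> lies strictly between
  two points of the polytope.\<close>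

lemma extreme_point_eq_if_same_support:
  assumes q: "q extreme_point_of kernel_polytope W" and r: "r \<in> kernel_polytope W"
    and supp: "{i. q $ i \<noteq> 0} = {i. r $ i \<noteq> 0}"
  shows "q = r"
proof (rule ccontr)
  assume "q \<noteq> r"
  have qP: "q \<in> kernel_polytope W" using q by (simp add: extreme_point_of_def)
  have nn: "0 \<le> q $ i" "0 \<le> r $ i" for i using qP r by (auto simp: kernel_polytope_def)
  have ev: "\<forall>\<^sub>F e in at_right 0. 0 \<le> (1 + e) * q $ i + (- e) * r $ i" for i
  proof (cases "q $ i = 0")
    case True
    then have "r $ i = 0" using supp by blast
    then show ?thesis using True by simp
  next
    case False
    have "((\<lambda>e. (1 + e) * q $ i + (- e) * r $ i) \<longlongrightarrow> (1 + 0) * q $ i + (- 0) * r $ i) (at_right 0)"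
      by (intro tendsto_intros)
    then have "\<forall>\<^sub>F e in at_right 0. 0 < (1 + e) * q $ i + (- e) * r $ i"
      using False nn[of i] by (intro order_tendstoD) auto
    then show ?thesis by eventually_elim simp
  qed
  have "\<forall>\<^sub>F e in at_right 0. \<forall>i. 0 \<le> (1 + e) * q $ i + (- e) * r $ i"
    using ev by (intro eventually_all_finite)
  then have "\<forall>\<^sub>F e in at_right (0::real). 0 < e \<and> (\<forall>i. 0 \<le> (1 + e) * q $ i + (- e) * r $ i)"
    using eventually_at_right_less by (rule eventually_elim2) auto
  then obtain e :: real where e: "0 < e" "\<And>i. 0 \<le> (1 + e) * q $ i + (- e) * r $ i"
    using eventually_happens' trivial_limit_at_right_real by (metis (no_types, lifting))
  define p where "p = (1 + e) *\<^sub>R q + (- e) *\<^sub>R r"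
  have pP: "p \<in> kernel_polytope W"
    unfolding p_def by (intro kernel_polytope_affine qP r e) simp
  have "p - r = (1 + e) *\<^sub>R (q - r)" by (simp add: p_def algebra_simps)
  then have "p \<noteq> r" using \<open>q \<noteq> r\<close> e(1) by auto
  \<comment> \<open>This solves the definition of \<open>p\<close> for \<open>q\<close>; since
    \<open>e\<close> is positive, the weight of \<open>r\<close> lies strictly between 0 and
    1.\<close>
  moreover have "q = (1 - e / (1 + e)) *\<^sub>R p + (e / (1 + e)) *\<^sub>R r"
  proof -
    have "1 - e / (1 + e) = 1 / (1 + e)" using e(1) by (simp add: field_simps)
    then have "(1 - e / (1 + e)) *\<^sub>R p + (e / (1 + e)) *\<^sub>R r = (1 / (1 + e)) *\<^sub>R (p + e *\<^sub>R r)"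
      by (simp add: scaleR_add_right)
    also have "p + e *\<^sub>R r = (1 + e) *\<^sub>R q" by (simp add: p_def)
    finally show ?thesis using e(1) by simp
  qed
  ultimately have "q \<in> open_segment p r"
    using e(1) unfolding in_segment by (intro conjI exI[of _ "e / (1 + e)"]) auto
  then show False using q pP r by (auto simp: extreme_point_of_def)
qed

definition kernel_vertices where
  "kernel_vertices W = {q. q extreme_point_of kernel_polytope W}"

text \<open>A vertex is determined by its support, a subset of an index type with
  \<open>CARD('x)\<^sup>2 + CARD('y)\<^sup>2\<close> elements.\<close>

lemma
  fixes W :: "('x::finite, 'y::finite, 'z) mac"
  shows finite_kernel_vertices: "finite (kernel_vertices W)"
    and card_kernel_vertices: "card (kernel_vertices W) \<le> 2 ^ (CARD('x)\<^sup>2 + CARD('y)\<^sup>2)"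
proof -
  define supp where "supp q = {i. q $ i \<noteq> 0}" for q :: "real ^ (('x \<times> 'x) + ('y \<times> 'y))"
  have inj: "inj_on supp (kernel_vertices W)"
    unfolding supp_def kernel_vertices_def
    by (intro inj_onI extreme_point_eq_if_same_support[of _ W]) (auto simp: extreme_point_of_def)
  show "finite (kernel_vertices W)"
    using inj by (rule inj_on_finite[of _ _ UNIV]) auto
  have "card (kernel_vertices W) \<le> card (Pow (UNIV :: (('x \<times> 'x) + ('y \<times> 'y)) set))"
    using inj by (rule card_inj_on_le) auto
  then show "card (kernel_vertices W) \<le> 2 ^ (CARD('x)\<^sup>2 + CARD('y)\<^sup>2)"
    by (simp add: card_Pow power2_eq_square)
qed

section \<open>Channels as linear images of kernel pairs\<close>

text \<open>Only the \<open>Inl\<close> half appears: for \<open>q\<close> in the polytope, the last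
  constraint there makes the \<open>Inr\<close> half yield the same channel.\<close>

definition represents where
  "represents W q V \<longleftrightarrow> (\<forall>x y z. pmf (V x y) z = (\<Sum>x'\<in>UNIV. q $ Inl (x, x') * pmf (W x' y) z))"

lemma represents_unique: "represents W q V \<Longrightarrow> represents W q V' \<Longrightarrow> V = V'"
  unfolding represents_def by (intro ext pmf_eqI) simp

text \<open>Sign and row-sum constraints make the rows of \<open>q\<close> probability vectors; the
  last constraint makes the two input replacements agree.\<close>

lemma kernel_polytope_represents:
  fixes W :: "('x::finite, 'y::finite, 'z) mac"
  assumes q: "q \<in> kernel_polytope W"
  obtains V where "V \<in> W_tilde W" "represents W q V"
proof -
  have "\<exists>p. \<forall>x'. pmf p x' = q $ Inl (x, x')" for x
    using q pmf_with_weights[of UNIV "\<lambda>x'. q $ Inl (x, x')"]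
    by (metis (mono_tags, lifting) UNIV_I finite kernel_polytope_def mem_Collect_eq)
  then obtain QX where QX: "\<And>x x'. pmf (QX x) x' = q $ Inl (x, x')" by metis
  have "\<exists>p. \<forall>y'. pmf p y' = q $ Inr (y, y')" for y
    using q pmf_with_weights[of UNIV "\<lambda>y'. q $ Inr (y, y')"]
    by (metis (mono_tags, lifting) UNIV_I finite kernel_polytope_def mem_Collect_eq)
  then obtain QY where QY: "\<And>y y'. pmf (QY y) y' = q $ Inr (y, y')" by metis
  define V where "V x y = bind_pmf (QX x) (\<lambda>x'. W x' y)" for x y
  have rep: "represents W q V"
    by (simp add: represents_def V_def pmf_bind_finite[OF finite[of UNIV]] QX)
  have "V \<in> W_tilde W"
    unfolding W_tilde_def mem_Collect_eq
    by (rule exI[of _ QX], rule exI[of _ QY])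
      (use q rep in \<open>simp add: QX QY represents_def kernel_polytope_def\<close>)
  then show ?thesis using rep that by blast
qed

lemma W_tilde_represented:
  fixes W :: "('x::finite, 'y::finite, 'z) mac"
  assumes "V \<in> W_tilde W"
  obtains q where "q \<in> kernel_polytope W" "represents W q V"
proof -
  obtain QX QY where Q:
    "\<And>x y z. pmf (V x y) z = (\<Sum>x'\<in>UNIV. pmf (QX x) x' * pmf (W x' y) z)"
    "\<And>x y z. pmf (V x y) z = (\<Sum>y'\<in>UNIV. pmf (QY y) y' * pmf (W x y') z)"
    using assms unfolding W_tilde_def by blast
  define q :: "real ^ (('x \<times> 'x) + ('y \<times> 'y))" where
    "q = (\<chi> i. case i of Inl (x, x') \<Rightarrow> pmf (QX x) x' | Inr (y, y') \<Rightarrow> pmf (QY y) y')"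
  show ?thesis
  proof (rule that)
    show "q \<in> kernel_polytope W"
      by (auto simp: kernel_polytope_def q_def sum_pmf_eq_1 Q[symmetric] split: sum.split)
    show "represents W q V" by (simp add: represents_def q_def Q(1))
  qed
qed

text \<open>A represented channel is linear in \<open>q\<close>, and \<open>q\<close> is a convex
  combination of vertices. The convex weights thus become one mixing law, common to all inputs, on
  the channels of the vertices.\<close>

lemma W_tilde_finite_mixture:
  fixes W :: "('x::finite, 'y::finite, 'z) mac"
  obtains T where "T \<subseteq> W_tilde W" "T \<noteq> {}" "finite T"
    "card T \<le> 2 ^ (CARD('x)\<^sup>2 + CARD('y)\<^sup>2)"
    "\<And>V. V \<in> W_tilde W \<Longrightarrow> \<exists>U. set_pmf U \<subseteq> T \<and> (\<forall>x y. V x y = bind_pmf U (\<lambda>V'. V' x y))"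
proof -
  define E where "E = kernel_vertices W"
  have finE: "finite E" using finite_kernel_vertices E_def by metis
  have hull: "kernel_polytope W = convex hull E"
    unfolding E_def kernel_vertices_def
    by (intro Krein_Milman_Minkowski compact_kernel_polytope convex_kernel_polytope)
  have EP: "E \<subseteq> kernel_polytope W" by (auto simp: E_def kernel_vertices_def extreme_point_of_def)
  obtain F where F: "\<And>q. q \<in> kernel_polytope W \<Longrightarrow> F q \<in> W_tilde W"
      "\<And>q. q \<in> kernel_polytope W \<Longrightarrow> represents W q (F q)"
    using kernel_polytope_represents by metis
  show ?thesis
  proof (rule that[of "F ` E"])
    show "F ` E \<subseteq> W_tilde W" using F(1) EP by blast
    \<comment> \<open>A nonempty polytope has a vertex, as the hull of the empty set is
      empty.\<close>
    have "kernel_polytope W \<noteq> {}" using W_tilde_represented[OF W_tilde_self] by blast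
    then show "F ` E \<noteq> {}" using hull by auto
    show "finite (F ` E)" using finE by simp
    have "card (F ` E) \<le> card E" using finE by (rule card_image_le)
    then show "card (F ` E) \<le> 2 ^ (CARD('x)\<^sup>2 + CARD('y)\<^sup>2)"
      using card_kernel_vertices[of W] by (simp add: E_def)
    fix V assume "V \<in> W_tilde W"
    then obtain q where q: "q \<in> kernel_polytope W" "represents W q V"
      by (rule W_tilde_represented)
    then obtain u where u: "\<forall>e\<in>E. 0 \<le> u e" "sum u E = 1" "(\<Sum>e\<in>E. u e *\<^sub>R e) = q"
      unfolding hull convex_hull_finite[OF finE] by auto
    obtain p where p: "set_pmf p \<subseteq> E" "\<And>e. e \<in> E \<Longrightarrow> pmf p e = u e"
      using pmf_with_weights[of E u] finE u by blast
    have comp: "q $ i = (\<Sum>e\<in>E. u e * e $ i)" for i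
      unfolding u(3)[symmetric] by (simp add: sum_component)
    have "represents W q (\<lambda>x y. bind_pmf p (\<lambda>e. F e x y))"
      unfolding represents_def
    proof (intro allI)
      fix x y z
      have "pmf (bind_pmf p (\<lambda>e. F e x y)) z = (\<Sum>e\<in>E. u e * pmf (F e x y) z)"
        using p by (simp add: pmf_bind_finite[OF finE p(1)])
      also have "\<dots> = (\<Sum>e\<in>E. u e * (\<Sum>x'\<in>UNIV. e $ Inl (x, x') * pmf (W x' y) z))"
        using F(2) EP by (intro sum.cong) (auto simp: represents_def)
      also have "\<dots> = (\<Sum>x'\<in>UNIV. q $ Inl (x, x') * pmf (W x' y) z)"
        unfolding comp sum_distrib_left sum_distrib_right
        by (subst sum.swap) (simp add: mult.assoc)
      finally show "pmf (bind_pmf p (\<lambda>e. F e x y)) z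
          = (\<Sum>x'\<in>UNIV. q $ Inl (x, x') * pmf (W x' y) z)" .
    qed
    then have "V = (\<lambda>x y. bind_pmf p (\<lambda>e. F e x y))" using q(2) represents_unique by blast
    \<comment> \<open>Distinct vertices may give the same channel, so the law on vertices is pushed
      forward along \<open>F\<close>.\<close>
    then have "\<forall>x y. V x y = bind_pmf (map_pmf F p) (\<lambda>V'. V' x y)"
      by (simp add: bind_map_pmf)
    then show "\<exists>U. set_pmf U \<subseteq> F ` E \<and> (\<forall>x y. V x y = bind_pmf U (\<lambda>V'. V' x y))"
      using p(1) by (intro exI[of _ "map_pmf F p"]) auto
  qed
qed

theorem theorem4:
  fixes W :: "('x::finite, 'y::finite, 'z::finite) mac"
  shows "adv_id_capacity W \<subseteq> C_AV_MAC (W_tilde W) \<and>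
    (\<exists>\<W> :: ('x, 'y, 'z) mac set.
        \<W> \<noteq> {} \<and> finite \<W> \<and>
        C_AV_MAC \<W> = C_AV_MAC (W_tilde W) \<and>
        card \<W> \<le> 2 ^ (CARD('x)\<^sup>2 + CARD('y)\<^sup>2))"
proof
  show "adv_id_capacity W \<subseteq> C_AV_MAC (W_tilde W)"
    unfolding adv_id_capacity_def C_AV_MAC_def av_capacity_def
    by (intro closure_mono Collect_mono impI av_achievable_if_adv_id_achievable)
  obtain T where T: "T \<subseteq> W_tilde W" "T \<noteq> {}" "finite T"
    "card T \<le> 2 ^ (CARD('x)\<^sup>2 + CARD('y)\<^sup>2)"
    "\<And>V. V \<in> W_tilde W \<Longrightarrow> \<exists>U. set_pmf U \<subseteq> T \<and> (\<forall>x y. V x y = bind_pmf U (\<lambda>V'. V' x y))"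
    using W_tilde_finite_mixture by blast
  have "err_av (W_tilde W) (\<lambda>V. V) NA NB n fA fB \<phi> = err_av T (\<lambda>V. V) NA NB n fA fB \<phi>"
    for NA NB n fA fB \<phi>
    using T by (intro err_av_mixture)
  \<comment> \<open>The errors agree for every code, so already the sets of achievable pairs
    coincide, before taking closures.\<close>
  then have "C_AV_MAC T = C_AV_MAC (W_tilde W)"
    by (simp add: C_AV_MAC_def av_capacity_def av_achievable_def)
  then show "\<exists>\<W> :: ('x, 'y, 'z) mac set. \<W> \<noteq> {} \<and> finite \<W> \<and>
        C_AV_MAC \<W> = C_AV_MAC (W_tilde W) \<and> card \<W> \<le> 2 ^ (CARD('x)\<^sup>2 + CARD('y)\<^sup>2)"
    using T by blast
qed

end
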